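(* Let $\mathcal{A}=\{A_1,\ldots,A_m\}$ be an arrangement of finite cameras with principal rays $\mathbf{n}_1,\ldots,\mathbf{n}_m\in\mathbb{R}^4$. If the chiral domain $D_\mathcal{A}$ is nonempty, then $$D_\mathcal{A}=\left\{\mathbf{q}\in\mathbb{P}^3 \ :\ (\mathbf{n}_\infty^\top\mathbf{q})(\mathbf{n}_i^\top\mathbf{q})\ge 0 \ \text{ and }\ (\mathbf{n}_i^\top\mathbf{q})(\mathbf{n}_j^\top\mathbf{q})\ge 0\ \text{ for all } i,j\in\{1,\ldots,m\}\right\}.$$
   Context: $\mathbb{P}^3=(\mathbb{R}^4\setminus\{0\})/\!\sim$ is real projective space with the quotient topology induced from the Euclidean topology on $\mathbb{R}^4\setminus\{0\}$. A point $\mathbf{q}\in\mathbb{P}^3$ is finite if $q_4\neq 0$. Put $\mathbf{n}_\infty=(0,0,0,1)^\top$. A camera is a rank-3 matrix $A=[\,G\ \ \mathbf{t}\,]\in\mathbb{R}^{3\times 4}$ with $G\in\mathbb{R}^{3\times3}$, $\mathbf{t}\in\mathbb{R}^3$; it is finite if $\det G\ne 0$. Its center is the unique point of $\mathbb{P}^3$ spanning the kernel of $A$. Its principal ray is $\mathbf{n}_A=\det(G)\,A_{3,\bullet}^\top\in\mathbb{R}^4$, where $A_{3,\bullet}$ is the third row of $A$; $\mathbf{n}_i:=\mathbf{n}_{A_i}$. An arrangement is a finite nonempty collection of cameras with pairwise distinct centers. For a finite point $\mathbf{q}$ and a finite camera $A$, $\operatorname{depth}(\mathbf{q};A)=\frac{1}{|\det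 G|\,\|G_{3,\bullet}\|}\cdot\frac{\mathbf{n}_A^\top\mathbf{q}}{\mathbf{n}_\infty^\top\mathbf{q}}$, where $G_{3,\bullet}$ is the third row of $G$. The chiral domain $D_\mathcal{A}$ is the closure in $\mathbb{P}^3$ of $\{\mathbf{q}\in\mathbb{P}^3:\mathbf{q}\text{ finite and }\operatorname{depth}(\mathbf{q};A)>0\ \ \forall A\in\mathcal{A}\}$. The inequalities in the claim are well defined on $\mathbb{P}^3$ because they are homogeneous of degree 2 in $\mathbf{q}$. *)

theory Defs
  imports "HOL-Analysis.Analysis"
begin

definition proj_rel :: "real^4 \<Rightarrow> real^4 \<Rightarrow> bool"
  where "proj_rel x y \<longleftrightarrow> x \<noteq> 0 \<and> y \<noteq> 0 \<and> (\<exists>c. c \<noteq> 0 \<and> y = c *\<^sub>R x)"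

lemma proj_rel_refl_iff: "proj_rel x x \<longleftrightarrow> x \<noteq> 0"
  by (auto simp: proj_rel_def intro!: exI[of _ 1])

lemma part_equivp_proj_rel: "part_equivp proj_rel"
proof (rule part_equivpI)
  show "\<exists>x. proj_rel x x"
    by (auto simp: proj_rel_refl_iff intro!: exI[of _ "axis 4 1"] simp: axis_eq_0_iff)
  show "symp proj_rel"
  proof (rule sympI)
    fix x y assume "proj_rel x y"
    then obtain c where "x \<noteq> 0" "y \<noteq> 0" "c \<noteq> 0" "y = c *\<^sub>R x"
      by (auto simp: proj_rel_def)
    then show "proj_rel y x"
      by (auto simp: proj_rel_def intro!: exI[of _ "inverse c"])
  qed
  show "transp proj_rel"
  proof (rule transpI)
    fix x y z assume "proj_rel x y" "proj_rel y z"
    then obtain c d where "x \<noteq> 0" "z \<noteq> 0" "c \<noteq> 0" "d \<noteq> 0" "z = (d * c) *\<^sub>R x"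
      by (auto simp: proj_rel_def)
    then show "proj_rel x z"
      by (auto simp: proj_rel_def intro!: exI[of _ "d * c"])
  qed
qed

quotient_type p3 = "real^4" / partial: proj_rel
  by (rule part_equivp_proj_rel)

text \<open>The relation is partial: only nonzero vectors represent points, and
  \<open>abs_p3 0\<close> is an unspecified point.\<close>

instantiation p3 :: topological_space
begin

definition open_p3 :: "p3 set \<Rightarrow> bool"
  where "open_p3 U \<longleftrightarrow> openin (top_of_set (UNIV - {0})) {x \<in> UNIV - {0}. abs_p3 x \<in> U}"

instance
proof
  show "open (UNIV :: p3 set)"
    by (simp add: open_p3_def set_diff_eq)
next
  fix S T :: "p3 set"
  assume "open S" "open T"
  moreover have "{x \<in> UNIV - {0}. abs_p3 x \<in> S \<inter> T} =
      {x \<in> UNIV - {0}. abs_p3 x \<in> S} \<inter> {x \<in> UNIV - {0}. abs_p3 x \<in> T}"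
    by blast
  ultimately show "open (S \<inter> T)"
    by (simp only: open_p3_def openin_Int)
next
  fix K :: "p3 set set"
  assume "\<forall>S\<in>K. open S"
  then have "openin (top_of_set (UNIV - {0})) (\<Union>S\<in>K. {x \<in> UNIV - {0}. abs_p3 x \<in> S})"
    by (intro openin_Union) (auto simp: open_p3_def)
  moreover have "(\<Union>S\<in>K. {x \<in> UNIV - {0}. abs_p3 x \<in> S}) =
      {x \<in> UNIV - {0}. abs_p3 x \<in> \<Union>K}"
    by blast
  ultimately show "open (\<Union>K)"
    by (simp only: open_p3_def)
qed

end

lemma quotient_map_abs_p3:
  "quotient_map (top_of_set (UNIV - {0})) euclidean abs_p3"
proof -
  have "q \<in> abs_p3 ` (UNIV - {0})" for q
    by (induct q rule: p3.abs_induct) (simp add: proj_rel_refl_iff)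
  then have "abs_p3 ` (UNIV - {0}) = UNIV"
    by blast
  then show ?thesis
    by (simp add: quotient_map_def open_p3_def)
qed

definition n_inf :: "real^4"
  where "n_inf = vector [0, 0, 0, 1]"

lift_definition finite_point :: "p3 \<Rightarrow> bool" is "\<lambda>q. q $ 4 \<noteq> 0"
  by (auto simp: proj_rel_def)

text \<open>The left \<open>3 \<times> 3\<close> block of a \<open>3 \<times> 4\<close> matrix.\<close>

definition Gmat :: "real^4^3 \<Rightarrow> real^3^3"
  where "Gmat A = (\<chi> i. vector [A $ i $ 1, A $ i $ 2, A $ i $ 3])"

definition camera :: "real^4^3 \<Rightarrow> bool"
  where "camera A \<longleftrightarrow> rank A = 3"

definition finite_camera :: "real^4^3 \<Rightarrow> bool"
  where "finite_camera A \<longleftrightarrow> camera A \<and> det (Gmat A) \<noteq> 0"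

lift_definition line_of :: "p3 \<Rightarrow> (real^4) set" is "\<lambda>q. span {q}"
proof -
  fix x y :: "real^4"
  assume "proj_rel x y"
  then obtain c where "c \<noteq> 0" "y = c *\<^sub>R x"
    by (auto simp: proj_rel_def)
  then show "span {x} = span {y}"
    using span_image_scale[of "{x}" "\<lambda>_. c"] by simp
qed

definition center :: "real^4^3 \<Rightarrow> p3"
  where "center A = (THE q. line_of q = {x. A *v x = 0})"

lemma ex1_center:
  assumes "camera A"
  shows "\<exists>!q. line_of q = {x. A *v x = 0}"
proof (rule ex_ex1I)
  let ?N = "{x. A *v x = 0}"
  have "A *v y = 0" if "\<forall>x\<in>span (rows A). orthogonal x y" for y
  proof -
    have "A $ i \<in> span (rows A)" for i
      by (rule span_base) (auto simp: rows_def row_def)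
    with that show ?thesis
      by (simp add: vec_eq_iff matrix_vector_mul_component orthogonal_def)
  qed
  then have "?N = {y \<in> UNIV. \<forall>x\<in>span (rows A). orthogonal x y}"
    by (auto simp: orthogonal_commute intro: orthogonal_nullspace_rowspace)
  moreover have "dim {y \<in> UNIV. \<forall>x\<in>span (rows A). orthogonal x y} + dim (span (rows A)) =
      dim (UNIV :: (real^4) set)"
    by (rule dim_subspace_orthogonal_to_vectors) auto
  moreover have "dim (span (rows A)) = 3"
    using assms by (simp add: camera_def row_rank_def)
  ultimately have "dim ?N = 1"
    by simp
  moreover have "subspace ?N"
    by (auto simp: subspace_def matrix_vector_right_distrib matrix_vector_mult_scaleR)
  moreover obtain B where B: "B \<subseteq> ?N" "independent B" "?N \<subseteq> span B" "card B = dim ?N"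
    by (rule basis_exists)
  ultimately have "span B = ?N" "card B = 1"
    using span_subspace [of B ?N] by simp_all
  moreover from this obtain x where x: "B = {x}"
    by (auto simp: card_1_singleton_iff)
  ultimately have N: "span {x} = ?N" and "x \<noteq> 0"
    using B by auto
  then have "line_of (abs_p3 x) = span {x}"
    by (simp add: line_of.abs_eq proj_rel_refl_iff)
  with N show "\<exists>q. line_of q = ?N"
    by metis
next
  fix p q assume "line_of p = {x. A *v x = 0}" "line_of q = {x. A *v x = 0}"
  then have "line_of p = line_of q" by simp
  then show "p = q"
  proof transfer
    fix x y :: "real^4"
    assume xy: "proj_rel x x" "proj_rel y y" "span {x} = span {y}"
    then have "y \<in> span {x}"
      by (simp add: span_base)
    then obtain c where "y = c *\<^sub>R x"
      by (auto simp: span_singleton)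
    with xy show "proj_rel x y"
      by (auto simp: proj_rel_def)
  qed
qed

definition principal_ray :: "real^4^3 \<Rightarrow> real^4"
  where "principal_ray A = det (Gmat A) *\<^sub>R A $ 3"

text \<open>Families of cameras are indexed by \<open>1, \<dots>, m\<close>.\<close>

definition arrangement :: "nat \<Rightarrow> (nat \<Rightarrow> real^4^3) \<Rightarrow> bool"
  where "arrangement m A \<longleftrightarrow>
    m \<ge> 1 \<and> (\<forall>i\<in>{1..m}. camera (A i)) \<and> inj_on (\<lambda>i. center (A i)) {1..m}"

text \<open>Only meaningful for finite points and finite cameras; division by zero gives \<open>0\<close>
  otherwise.\<close>

lift_definition depth :: "p3 \<Rightarrow> real^4^3 \<Rightarrow> real" is
  "\<lambda>q A. 1 / (\<bar>det (Gmat A)\<bar> * norm (Gmat A $ 3)) *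
     ((principal_ray A \<bullet> q) / (n_inf \<bullet> q))"
  by (auto simp: proj_rel_def)

definition chiral_domain :: "nat \<Rightarrow> (nat \<Rightarrow> real^4^3) \<Rightarrow> p3 set"
  where "chiral_domain m A =
    closure {q. finite_point q \<and> (\<forall>i\<in>{1..m}. depth q (A i) > 0)}"

lift_definition nonneg_product :: "real^4 \<Rightarrow> real^4 \<Rightarrow> p3 \<Rightarrow> bool" is
  "\<lambda>a b q. (a \<bullet> q) * (b \<bullet> q) \<ge> 0"
proof -
  fix a b x y :: "real^4"
  assume "proj_rel x y"
  then obtain c where c: "c \<noteq> 0" "y = c *\<^sub>R x"
    by (auto simp: proj_rel_def)
  have "(a \<bullet> y) * (b \<bullet> y) = c\<^sup>2 * ((a \<bullet> x) * (b \<bullet> x))"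
    by (simp add: c power2_eq_square)
  moreover have "c\<^sup>2 > 0"
    using c by simp
  ultimately show "(0 \<le> (a \<bullet> x) * (b \<bullet> x)) = (0 \<le> (a \<bullet> y) * (b \<bullet> y))"
    by (simp only: zero_le_mult_iff [of "c\<^sup>2"]) auto
qed

end

theory Submission
  imports Defs
begin

text \<open>
  Let \<open>F\<close> consist of \<open>n_inf\<close> and the principal rays. A sign change of the representative reverses
  the signs of all linear forms \<open>u \<bullet> x\<close>, \<open>u \<in> F\<close>, at once, and both sides of the claim are images of
  cones in \<open>\<real>\<^sup>4\<close> under the projection: the points of positive depth come from the open
  cone \<open>u \<bullet> x > 0\<close> (\<open>positive_depths_eq_image_cone\<close>), and pairwise nonnegativity of the products says
  precisely that \<open>x\<close> or \<open>-x\<close> satisfies \<open>u \<bullet> x \<ge> 0\<close> for all \<open>u \<in> F\<close>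
  (\<open>pairwise_nonneg_imp_common_sign\<close>).

  One inclusion holds because the products are continuous, so that the conditions on them
  define a closed set (\<open>closed_nonneg_product\<close>). For the other, nonemptiness of the
  closure gives a point \<open>y\<close> of the open cone. If \<open>x \<noteq> 0\<close> lies in the closed cone, then
  \<open>x + t y\<close> lies in the open cone for every \<open>t > 0\<close>, and letting \<open>t\<close> tend to \<open>0\<close> exhibits the class of
  \<open>x\<close> as a limit of points of positive depth (\<open>nonneg_cone_in_closure\<close>).
\<close>

lemma p3_representative:
  obtains x where "x \<noteq> 0" "q = abs_p3 x"
  by (induct q rule: p3.abs_induct) (auto simp: proj_rel_refl_iff)

lemma abs_p3_uminus: "x \<noteq> 0 \<Longrightarrow> abs_p3 (- x) = abs_p3 x"
  by (rule Quotient3_rel_abs [OF Quotient3_p3]) (auto simp: proj_rel_def intro!: exI [of _ "- 1"])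

lemma isCont_abs_p3:
  assumes "x \<noteq> 0"
  shows "isCont abs_p3 x"
proof -
  have "continuous_on (UNIV - {0}) abs_p3"
    using quotient_imp_continuous_map [OF quotient_map_abs_p3] by simp
  then show ?thesis
    using assms by (simp add: continuous_on_eq_continuous_at open_delete)
qed

lemma nonneg_product_abs_p3:
  "x \<noteq> 0 \<Longrightarrow> nonneg_product a b (abs_p3 x) \<longleftrightarrow> 0 \<le> (a \<bullet> x) * (b \<bullet> x)"
  by (simp add: nonneg_product.abs_eq proj_rel_refl_iff)

lemma closed_nonneg_product: "closed {q. nonneg_product a b q}"
proof -
  have "{x \<in> UNIV - {0}. abs_p3 x \<in> - {q. nonneg_product a b q}} =
      (UNIV - {0}) \<inter> {x. (a \<bullet> x) * (b \<bullet> x) < 0}"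
    by (auto simp: nonneg_product_abs_p3)
  moreover have "open {x. (a \<bullet> x) * (b \<bullet> x) < 0}"
    by (intro open_Collect_less continuous_intros)
  ultimately show ?thesis
    by (simp add: closed_def open_p3_def openin_open_Int)
qed

definition positive_cone :: "'a::real_inner set \<Rightarrow> 'a set"
  where "positive_cone F = {x. \<forall>u\<in>F. 0 < u \<bullet> x}"

text \<open>
  A segment from \<open>x\<close> into the open cone meets the closed cone's boundary at most in its
  starting point. The forms are allowed to vanish at \<open>x\<close>, even all of them; \<open>x \<noteq> 0\<close>
  is what lets the limit pass to projective space.
\<close>

lemma nonneg_cone_in_closure:
  assumes "y \<in> positive_cone F" and "x \<noteq> 0" and "\<forall>u\<in>F. 0 \<le> u \<bullet> x"
  shows "abs_p3 x \<in> closure (abs_p3 ` positive_cone F)"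
proof (rule Lim_in_closed_set)
  show "\<forall>\<^sub>F t in at_right (0::real).
      abs_p3 (x + t *\<^sub>R y) \<in> closure (abs_p3 ` positive_cone F)"
  proof (rule eventually_at_right_less [THEN eventually_mono])
    fix t :: real
    assume "0 < t"
    then have "x + t *\<^sub>R y \<in> positive_cone F"
      using assms by (auto simp: positive_cone_def inner_add_right intro!: add_nonneg_pos)
    then show "abs_p3 (x + t *\<^sub>R y) \<in> closure (abs_p3 ` positive_cone F)"
      by (intro subsetD [OF closure_subset] imageI)
  qed
  have "((\<lambda>t. x + t *\<^sub>R y) \<longlongrightarrow> x + 0 *\<^sub>R y) (at_right (0::real))"
    by (intro tendsto_intros)
  then show "((\<lambda>t. abs_p3 (x + t *\<^sub>R y)) \<longlongrightarrow> abs_p3 x) (at_right (0::real))"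
    using isCont_tendsto_compose [OF isCont_abs_p3 [OF \<open>x \<noteq> 0\<close>]] by simp
qed auto

lemma pairwise_nonneg_imp_common_sign:
  fixes f :: "'a \<Rightarrow> real"
  assumes "\<And>u v. u \<in> F \<Longrightarrow> v \<in> F \<Longrightarrow> 0 \<le> f u * f v"
  shows "(\<forall>u\<in>F. 0 \<le> f u) \<or> (\<forall>u\<in>F. f u \<le> 0)"
  using assms by (metis linorder_not_le mult_neg_pos)

lemma n_inf_inner: "n_inf \<bullet> x = x $ 4"
  by (simp add: n_inf_def inner_vec_def sum_4 vector_def)

text \<open>
  For a finite camera the normalising factor of the depth is positive: a zero third row would
  make the determinant vanish.
\<close>

lemma depth_pos_iff:
  assumes "det (Gmat A) \<noteq> 0" and "x \<noteq> 0"
  shows "0 < depth (abs_p3 x) A \<longleftrightarrow> 0 < (principal_ray A \<bullet> x) / (n_inf \<bullet> x)"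
proof -
  have "Gmat A $ 3 \<noteq> 0"
    using assms(1) det_zero_row(1) [of 3 "Gmat A"] by (auto simp: row_def)
  then have "0 < 1 / (\<bar>det (Gmat A)\<bar> * norm (Gmat A $ 3))"
    using assms(1) by simp
  moreover have "depth (abs_p3 x) A = 1 / (\<bar>det (Gmat A)\<bar> * norm (Gmat A $ 3)) *
      ((principal_ray A \<bullet> x) / (n_inf \<bullet> x))"
    using assms(2) by (simp add: depth.abs_eq proj_rel_refl_iff)
  ultimately show ?thesis
    by (simp only: zero_less_mult_iff) auto
qed

text \<open>
  Positive depth fixes the signs of the principal rays relative to that of \<open>n_inf\<close>; choosing the
  representative with \<open>n_inf \<bullet> x > 0\<close> makes all of them positive.
\<close>

lemma positive_depths_eq_image_cone:
  assumes "\<forall>i\<in>I. det (Gmat (A i)) \<noteq> 0"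
  shows "{q. finite_point q \<and> (\<forall>i\<in>I. 0 < depth q (A i))} =
    abs_p3 ` positive_cone (insert n_inf ((\<lambda>i. principal_ray (A i)) ` I))"
    (is "?D = abs_p3 ` ?C")
proof (intro subset_antisym subsetI)
  fix q assume q: "q \<in> ?D"
  obtain x where x: "x \<noteq> 0" "q = abs_p3 x"
    by (rule p3_representative)
  have "n_inf \<bullet> x \<noteq> 0"
    using q x by (simp add: finite_point.abs_eq proj_rel_refl_iff n_inf_inner)
  moreover have "0 < (principal_ray (A i) \<bullet> x) / (n_inf \<bullet> x)" if "i \<in> I" for i
    using q x assms that by (simp add: depth_pos_iff)
  ultimately have "x \<in> ?C \<or> - x \<in> ?C"
    by (cases "0 < n_inf \<bullet> x") (auto simp: positive_cone_def zero_less_divide_iff)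
  then show "q \<in> abs_p3 ` ?C"
    using x by (metis abs_p3_uminus imageI)
next
  fix q assume "q \<in> abs_p3 ` ?C"
  then obtain x where x: "x \<in> ?C" "q = abs_p3 x"
    by blast
  then have "x \<noteq> 0"
    by (auto simp: positive_cone_def)
  then show "q \<in> ?D"
    using x assms
    by (auto simp: positive_cone_def depth_pos_iff finite_point.abs_eq proj_rel_refl_iff
        n_inf_inner)
qed

theorem theorem1:
  fixes m :: nat and A :: "nat \<Rightarrow> real^4^3"
  assumes "arrangement m A"
    and "\<forall>i\<in>{1..m}. finite_camera (A i)"
    and "chiral_domain m A \<noteq> {}"
  shows "chiral_domain m A =
    {q. \<forall>i\<in>{1..m}. \<forall>j\<in>{1..m}.
          nonneg_product n_inf (principal_ray (A i)) q \<and>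
          nonneg_product (principal_ray (A i)) (principal_ray (A j)) q}"
    (is "_ = ?R")
proof -
  define F where "F = insert n_inf ((\<lambda>i. principal_ray (A i)) ` {1..m})"
  have D: "chiral_domain m A = closure (abs_p3 ` positive_cone F)"
    using assms(2) positive_depths_eq_image_cone [of "{1..m}" A]
    by (simp add: chiral_domain_def F_def finite_camera_def)
  then obtain y where y: "y \<in> positive_cone F"
    using assms(3) by fastforce
  show ?thesis
  proof (intro subset_antisym subsetI)
    have "?R = (\<Inter>i\<in>{1..m}. \<Inter>j\<in>{1..m}.
        {q. nonneg_product n_inf (principal_ray (A i)) q} \<inter>
        {q. nonneg_product (principal_ray (A i)) (principal_ray (A j)) q})"
      by blast
    also have "closed \<dots>"
      by (intro closed_INT ballI closed_Int closed_nonneg_product)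
    finally have "closed ?R" .
    moreover have "abs_p3 ` positive_cone F \<subseteq> ?R"
    proof (intro image_subsetI CollectI ballI)
      fix x i j assume x: "x \<in> positive_cone F" and "i \<in> {1..m}" "j \<in> {1..m}"
      moreover from x have "x \<noteq> 0"
        by (auto simp: positive_cone_def F_def)
      ultimately show "nonneg_product n_inf (principal_ray (A i)) (abs_p3 x) \<and>
          nonneg_product (principal_ray (A i)) (principal_ray (A j)) (abs_p3 x)"
        by (auto simp: nonneg_product_abs_p3 positive_cone_def F_def
            intro!: mult_nonneg_nonneg less_imp_le)
    qed
    ultimately have "chiral_domain m A \<subseteq> ?R"
      unfolding D by (rule closure_minimal [rotated])
    then show "q \<in> ?R" if "q \<in> chiral_domain m A" for q
      using that by (rule subsetD)
  next
    fix q assume q: "q \<in> ?R"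
    obtain x where x: "x \<noteq> 0" "q = abs_p3 x"
      by (rule p3_representative)
    have "0 \<le> (u \<bullet> x) * (v \<bullet> x)" if "u \<in> F" "v \<in> F" for u v
      using q x that by (auto simp: F_def nonneg_product_abs_p3 mult.commute)
    then have "(\<forall>u\<in>F. 0 \<le> u \<bullet> x) \<or> (\<forall>u\<in>F. u \<bullet> x \<le> 0)"
      by (rule pairwise_nonneg_imp_common_sign)
    then have "\<exists>z. z \<noteq> 0 \<and> q = abs_p3 z \<and> (\<forall>u\<in>F. 0 \<le> u \<bullet> z)"
    proof
      assume "\<forall>u\<in>F. u \<bullet> x \<le> 0"
      then show ?thesis
        using x by (intro exI [of _ "- x"]) (simp add: abs_p3_uminus)
    qed (use x in blast)
    then show "q \<in> chiral_domain m A"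
      unfolding D using nonneg_cone_in_closure [OF y] by blast
  qed
qed

end
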